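(* Let $A,B\in su(1,1)$ be linearly independent over $\mathbb{R}$. The single-input control system $\dot X(t)=[A+u(t)B]X(t)$, $X(0)=I_2$, on $SU(1,1)$, with controls $u$ in an admissible control set $\mathcal{U}$, is uncontrollable on $SU(1,1)$ if the set $$\Omega=\left\{u\in\mathbb{R}\;\middle|\;\langle A+uB,\,A^{\dagger}+uB^{\dagger}\rangle<0\right\}$$ is empty.
   Context: $SU(1,1)$ is the Lie group of complex matrices $\begin{pmatrix} a & b\\ \bar b & \bar a\end{pmatrix}$ with $|a|^2-|b|^2=1$. Its Lie algebra $su(1,1)$ is the real span of $\bar K_x=\frac12\begin{pmatrix}0&-i\\ i&0\end{pmatrix}$, $\bar K_y=\frac12\begin{pmatrix}0&-1\\-1&0\end{pmatrix}$, $\bar K_z=\frac12\begin{pmatrix}-i&0\\0&i\end{pmatrix}$. For matrices $M,N$ put $\langle M,N\rangle=2\,\mathrm{Tr}(MN^{\dagger})$, where $N^\dagger$ is the conjugate transpose of $N$; thus $\langle M,N^\dagger\rangle=2\,\mathrm{Tr}(MN)$. The admissible control set $\mathcal{U}$ is any set of locally bounded measurable functions $u:[0,\infty)\to\mathbb{R}$. For $t\ge 0$, the reachable set $R(t)$ is the set of all $X_f\in SU(1,1)$ for which there is a control $u\in\mathcal{U}$ whose corresponding solution with $X(0)=I_2$ satisfies $X(t)=X_f$. The system is controllable on $SU(1,1)$ if $\bigcup_{0\le t<\infty}R(t)=SU(1,1)$, and uncontrollable otherwise. *)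

theory Defs
  imports "HOL-Analysis.Analysis" "HOL-Library.Complex_Order"
begin

definition SU11 :: "(complex^2^2) set" where
  "SU11 = {vector [vector [a, b], vector [cnj b, cnj a]] | a b. (cmod a)\<^sup>2 - (cmod b)\<^sup>2 = 1}"

definition K_x :: "complex^2^2" where
  "K_x = (1/2) *\<^sub>R vector [vector [0, - \<i>], vector [\<i>, 0]]"

definition K_y :: "complex^2^2" where
  "K_y = (1/2) *\<^sub>R vector [vector [0, - 1], vector [- 1, 0]]"

definition K_z :: "complex^2^2" where
  "K_z = (1/2) *\<^sub>R vector [vector [- \<i>, 0], vector [0, \<i>]]"

text \<open>Here \<open>span\<close> is the span over the reals.\<close>

definition su11 :: "(complex^2^2) set" where
  "su11 = span {K_x, K_y, K_z}"

definition dagger :: "complex^'n^'m \<Rightarrow> complex^'m^'n"  (\<open>(_\<^sup>\<dagger>)\<close> [1000] 999) where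
  "M\<^sup>\<dagger> = (\<chi> i j. cnj (M $ j $ i))"

definition pairing :: "complex^'n^'n \<Rightarrow> complex^'n^'n \<Rightarrow> complex"  (\<open>\<langle>_, _\<rangle>\<close>) where
  "\<langle>M, N\<rangle> = 2 * trace (M ** N\<^sup>\<dagger>)"

text \<open>The pairing is complex-valued; in the order of \<open>Complex_Order\<close>, \<open>z < 0\<close> says that
  \<open>z\<close> is real and negative. For \<open>A, B \<in> su11\<close> the value compared below is always real.\<close>

definition elliptic_controls :: "complex^2^2 \<Rightarrow> complex^2^2 \<Rightarrow> real set"  (\<open>\<Omega>\<close>) where
  "\<Omega> A B = {u::real. \<langle>A + u *\<^sub>R B, A\<^sup>\<dagger> + u *\<^sub>R B\<^sup>\<dagger>\<rangle> < 0}"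

text \<open>Controls are functions on \<open>[0, \<infinity>)\<close>; they are represented by total functions whose values
  at negative times play no role.\<close>

definition locally_bounded_measurable :: "(real \<Rightarrow> real) \<Rightarrow> bool" where
  "locally_bounded_measurable u \<longleftrightarrow>
     u \<in> borel_measurable (lebesgue_on {0..}) \<and> (\<forall>T\<ge>0. bounded (u ` {0..T}))"

text \<open>As \<open>u\<close> is only measurable, \<open>X' = (A + u B) X\<close>, \<open>X 0 = I\<close> is understood in the sense of
  Caratheodory: \<open>X\<close> is a continuous solution of the equivalent integral equation.\<close>

definition solution ::
    "complex^2^2 \<Rightarrow> complex^2^2 \<Rightarrow> (real \<Rightarrow> real) \<Rightarrow> (real \<Rightarrow> complex^2^2) \<Rightarrow> bool" where
  "solution A B u X \<longleftrightarrow>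
     continuous_on {0..} X \<and>
     (\<forall>t\<ge>0. set_integrable lebesgue {0..t} (\<lambda>s. (A + u s *\<^sub>R B) ** X s) \<and>
            X t = mat 1 + (LINT s:{0..t}|lebesgue. (A + u s *\<^sub>R B) ** X s))"

definition reachable_set ::
    "complex^2^2 \<Rightarrow> complex^2^2 \<Rightarrow> (real \<Rightarrow> real) set \<Rightarrow> real \<Rightarrow> (complex^2^2) set" where
  "reachable_set A B U t =
     {X\<^sub>f \<in> SU11. \<exists>u\<in>U. \<exists>X. solution A B u X \<and> X t = X\<^sub>f}"

definition controllable ::
    "complex^2^2 \<Rightarrow> complex^2^2 \<Rightarrow> (real \<Rightarrow> real) set \<Rightarrow> bool" where
  "controllable A B U \<longleftrightarrow> (\<Union>t\<in>{0..}. reachable_set A B U t) = SU11"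

end

theory Submission
  imports Defs
begin

text \<open>
  In the coordinates in which an element of \<open>su(1,1)\<close> is a pair \<open>(c, z)\<close> of a complex and a real
  number, \<open>\<langle>M, M\<^sup>\<dagger>\<rangle>\<close> is the Minkowski form \<open>\<bar>c\<bar>\<^sup>2 - z\<^sup>2\<close>. If no \<open>A + u B\<close> is elliptic, this form is
  nonnegative on the whole line \<open>A + u B\<close>, so that the discriminant of a quadratic polynomial in \<open>u\<close>
  is at most zero. This discriminant is, up to a positive factor, the value of the same form at the
  commutator \<open>[B, A]\<close> (\<open>commutator_causal\<close>). Hence \<open>[B, A]\<close> lies in one of the two closed
  causal cones.

  With \<open>J = diag(1, -1)\<close> the matrix \<open>\<i> J M\<close> is Hermitian for every \<open>M\<close> in \<open>su(1,1)\<close>, and it is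
  semidefinite exactly if \<open>M\<close> is causal. Along a solution, let \<open>v\<close> be the first column of \<open>X\<close>, and
  consider \<open>\<phi>(X) = v\<^sup>\<dagger> (\<i> J B) v\<close>; for \<open>X\<close> in \<open>SU(1,1)\<close> this is the \<open>z\<close>-coordinate of
  \<open>X\<^sup>-\<^sup>1 B X\<close>, up to a factor. Its derivative is \<open>v\<^sup>\<dagger> (\<i> J [B, A + u B]) v = v\<^sup>\<dagger> (\<i> J [B, A]) v\<close>,
  which does not contain the control, and which has a fixed sign because \<open>[B, A]\<close> is causal.
  So \<open>\<phi>\<close> is monotone along all solutions, in a direction that depends on \<open>A\<close> and \<open>B\<close> only
  (\<open>solution_hform_mono\<close>). But \<open>B\<close> is the limit of \<open>(A + u B) / u\<close>, so it is not elliptic either,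
  and for such \<open>B \<noteq> 0\<close> the function \<open>\<phi>\<close> takes values on both sides of \<open>\<phi>(I)\<close> on \<open>SU(1,1)\<close>
  (\<open>exists_SU11_hform_less\<close>). The points on the wrong side are unreachable.

  As the controls are only measurable, solutions are curves \<open>X = I + \<integral> g\<close> with \<open>g\<close> bounded on
  compact intervals, and \<open>\<phi>\<close> cannot be differentiated at every time. The derivative is replaced by
  an estimate of increments with an error quadratic in the length of the interval
  (\<open>quadratic_form_mono_along_integral_curve\<close>).
\<close>

section \<open>Monotone quadratic functions along integral curves\<close>

text \<open>Summing the step estimate over \<open>n\<close> equal subintervals gives the total defect
  \<open>n C (T / n)\<^sup>2\<close>, which tends to zero.\<close>

lemma nondecreasing_if_quadratic_defect:
  fixes f :: "real \<Rightarrow> real"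
  assumes T: "0 \<le> T"
    and step: "\<And>s t. 0 \<le> s \<Longrightarrow> s \<le> t \<Longrightarrow> t \<le> T \<Longrightarrow> f s - C * (t - s)\<^sup>2 \<le> f t"
  shows "f 0 \<le> f T"
proof -
  have fin: "f 0 - C * T\<^sup>2 / real n \<le> f T" if n: "n > 0" for n :: nat
  proof -
    define h where "h = T / real n"
    have h: "0 \<le> h" "real n * h = T" using T n by (auto simp: h_def)
    have "f 0 - real k * (C * h\<^sup>2) \<le> f (real k * h)" if "k \<le> n" for k
      using that
    proof (induction k)
      case (Suc k)
      have le: "real (Suc k) * h \<le> T"
        using mult_right_mono[of "real (Suc k)" "real n" h] Suc.prems h by simp
      have "f (real k * h) - C * (real (Suc k) * h - real k * h)\<^sup>2 \<le> f (real (Suc k) * h)"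
        using le h by (intro step) (auto intro: mult_right_mono)
      moreover have "real (Suc k) * h - real k * h = h" by (simp add: algebra_simps)
      ultimately show ?case using Suc by (simp add: algebra_simps)
    qed simp
    from this[of n] have "f 0 - real n * (C * h\<^sup>2) \<le> f T" using h by simp
    moreover have "real n * (C * h\<^sup>2) = C * T\<^sup>2 / real n"
      using n by (simp add: h_def power2_eq_square field_simps)
    ultimately show ?thesis by simp
  qed
  have "(\<lambda>n. f 0 - C * T\<^sup>2 / real n) \<longlonglongrightarrow> f 0 - 0"
    by (intro tendsto_diff tendsto_const lim_const_over_n)
  then show ?thesis
    using fin by (intro LIMSEQ_le_const2[where X = "\<lambda>n. f 0 - C * T\<^sup>2 / real n"])
      (auto intro!: exI[of _ 1])
qed

text \<open>Formally the derivative of \<open>S (X t) (X t)\<close> is \<open>2 S (X t) (g t) \<ge> 0\<close>, but \<open>g\<close> need not be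
  continuous anywhere. On \<open>[s, t]\<close> the increment is \<open>2 S (X s) d + S d d\<close> with \<open>d = \<integral> g\<close>.
  As \<open>X\<close> is Lipschitz, \<open>S (X s) (g r)\<close> differs from \<open>S (X r) (g r) \<ge> 0\<close> by \<open>O(t - s)\<close>, hence the
  increment is bounded below by \<open>- O((t - s)\<^sup>2)\<close>.\<close>

lemma quadratic_form_mono_along_integral_curve:
  fixes S :: "'a::euclidean_space \<Rightarrow> 'a \<Rightarrow> real" and X g :: "real \<Rightarrow> 'a"
  assumes S: "bounded_bilinear S" and sym: "\<And>x y. S x y = S y x"
    and T: "0 \<le> T" and int: "g integrable_on {0..T}"
    and X: "\<And>t. t \<in> {0..T} \<Longrightarrow> X t = X\<^sub>0 + integral {0..t} g"
    and bound: "\<And>t. t \<in> {0..T} \<Longrightarrow> norm (g t) \<le> L"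
    and pos: "\<And>t. t \<in> {0..T} \<Longrightarrow> 0 \<le> S (X t) (g t)"
  shows "S X\<^sub>0 X\<^sub>0 \<le> S (X T) (X T)"
proof -
  interpret S: bounded_bilinear S by (rule S)
  obtain K where K: "0 \<le> K" "\<And>x y. norm (S x y) \<le> norm x * norm y * K"
    using S.nonneg_bounded by blast
  have L: "0 \<le> L" using bound[of 0] T order_trans[OF norm_ge_zero, of "g 0" L] by simp
  have incr: "X t - X s = integral {s..t} g" and Lip: "norm (X t - X s) \<le> L * (t - s)"
    if st: "0 \<le> s" "s \<le> t" "t \<le> T" for s t
  proof -
    have "g integrable_on {0..t}" by (rule integrable_subinterval_real[OF int]) (use st in auto)
    from Henstock_Kurzweil_Integration.integral_combine[OF st(1,2) this]
    show *: "X t - X s = integral {s..t} g"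
      using X[of s] X[of t] st by (simp add: algebra_simps)
    have "g integrable_on {s..t}" by (rule integrable_subinterval_real[OF int]) (use st in auto)
    then show "norm (X t - X s) \<le> L * (t - s)" unfolding *
      using has_integral_bound_real[of L "{}" g "integral {s..t} g" s t] L bound st by auto
  qed
  have "S (X s) (X s) - 3 * K * L\<^sup>2 * (t - s)\<^sup>2 \<le> S (X t) (X t)"
    if st: "0 \<le> s" "s \<le> t" "t \<le> T" for s t
  proof -
    define d where "d = X t - X s"
    have d: "norm d \<le> L * (t - s)" using Lip[OF st] by (simp add: d_def)
    have int': "g integrable_on {s..t}" by (rule integrable_subinterval_real[OF int]) (use st in auto)
    have "\<bar>S d d\<bar> \<le> norm d * norm d * K" using K(2)[of d d] by simp
    also have "\<dots> \<le> (L * (t - s)) * (L * (t - s)) * K"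
      using d K(1) L st by (intro mult_right_mono mult_mono) auto
    finally have dd: "- (K * L\<^sup>2 * (t - s)\<^sup>2) \<le> S d d" by (simp add: power2_eq_square algebra_simps)
    have "(t - s) * - (K * L\<^sup>2 * (t - s)) = integral {s..t} (\<lambda>r. - (K * L\<^sup>2 * (t - s)))"
      using st by simp
    also have "\<dots> \<le> integral {s..t} (S (X s) \<circ> g)"
    proof (rule integral_le)
      show "(S (X s) \<circ> g) integrable_on {s..t}"
        by (rule integrable_linear[OF int' S.bounded_linear_right])
      fix r assume r: "r \<in> {s..t}"
      have "\<bar>S (X r - X s) (g r)\<bar> \<le> norm (X r - X s) * norm (g r) * K"
        using K(2)[of "X r - X s" "g r"] by simp
      also have "\<dots> \<le> (L * (t - s)) * L * K"
        using Lip[of s r] bound[of r] K(1) L st r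
          mult_left_mono[of "r - s" "t - s" L]
        by (intro mult_right_mono mult_mono) auto
      finally show "- (K * L\<^sup>2 * (t - s)) \<le> (S (X s) \<circ> g) r"
        using pos[of r] st r by (simp add: S.diff_left power2_eq_square algebra_simps)
    qed auto
    also have "\<dots> = S (X s) d"
      unfolding d_def incr[OF st] by (rule integral_linear[OF int' S.bounded_linear_right])
    finally have "- (K * L\<^sup>2 * (t - s)\<^sup>2) \<le> S (X s) d" by (simp add: power2_eq_square algebra_simps)
    moreover have "S (X t) (X t) = S (X s) (X s) + 2 * S (X s) d + S d d"
      using sym[of "X t" "X s"] by (simp add: d_def S.diff_left S.diff_right)
    ultimately show ?thesis using dd by simp
  qed
  from nondecreasing_if_quadratic_defect[OF T, of "\<lambda>t. S (X t) (X t)", OF this]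
  show ?thesis using X[of 0] T by simp
qed

section \<open>Coordinates on \<open>su(1,1)\<close>\<close>

definition su11_elem :: "complex \<Rightarrow> real \<Rightarrow> complex^2^2" where
  "su11_elem c z = (1/2) *\<^sub>R vector [vector [- \<i> * z, - \<i> * cnj c], vector [\<i> * c, \<i> * z]]"

lemma su11_elemE:
  assumes "M \<in> su11"
  obtains c z where "M = su11_elem c z"
proof -
  from assms obtain x y z where "M - x *\<^sub>R K_x - y *\<^sub>R K_y - z *\<^sub>R K_z = 0"
    unfolding su11_def span_insert span_empty by auto
  then have "M = x *\<^sub>R K_x + y *\<^sub>R K_y + z *\<^sub>R K_z" by (simp add: algebra_simps)
  also have "\<dots> = su11_elem (Complex x y) z"
    by (simp add: su11_elem_def K_x_def K_y_def K_z_def vec_eq_iff forall_2 complex_eq_iff)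
  finally show thesis by (rule that)
qed

lemma su11_elem_line:
  "su11_elem a p + u *\<^sub>R su11_elem b q = su11_elem (a + u *\<^sub>R b) (p + u * q)"
  by (simp add: su11_elem_def vec_eq_iff forall_2 complex_eq_iff algebra_simps)

lemma dagger_line: "A\<^sup>\<dagger> + u *\<^sub>R B\<^sup>\<dagger> = (A + u *\<^sub>R B)\<^sup>\<dagger>"
  by (simp add: dagger_def vec_eq_iff)

lemma pairing_su11_elem: "\<langle>su11_elem c z, (su11_elem c z)\<^sup>\<dagger>\<rangle> = complex_of_real ((cmod c)\<^sup>2 - z\<^sup>2)"
  unfolding cmod_power2
  by (simp add: pairing_def trace_def dagger_def matrix_matrix_mult_def su11_elem_def sum_2
      complex_eq_iff power2_eq_square algebra_simps)

text \<open>For \<open>M = su11_elem c z\<close> and \<open>J = diag(1, -1)\<close> the matrix \<open>2 \<i> J M\<close> is the Hermitian matrix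
  with rows \<open>(z, cnj c)\<close> and \<open>(c, z)\<close>; \<open>hform c z\<close> is the real part of its sesquilinear form,
  evaluated on first columns.\<close>

definition hform :: "complex \<Rightarrow> real \<Rightarrow> complex^2^2 \<Rightarrow> complex^2^2 \<Rightarrow> real" where
  "hform c z X Y = Re (cnj (X$1$1) * (z * Y$1$1 + cnj c * Y$2$1)
                     + cnj (X$2$1) * (c * Y$1$1 + z * Y$2$1))"

lemma hform_sym: "hform c z X Y = hform c z Y X"
  by (simp add: hform_def algebra_simps)

lemma bounded_bilinear_hform: "bounded_bilinear (hform c z)"
  unfolding bilinear_conv_bounded_bilinear[symmetric] bilinear_def
  by (auto intro!: linearI simp: hform_def algebra_simps)

lemma bounded_bilinear_matrix_mult:
  "bounded_bilinear ((**) :: complex^2^2 \<Rightarrow> complex^2^2 \<Rightarrow> complex^2^2)"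
  unfolding bilinear_conv_bounded_bilinear[symmetric] bilinear_def
  by (auto intro!: linearI simp: matrix_matrix_mult_def vec_eq_iff sum_2 algebra_simps)

text \<open>Since \<open>M\<^sup>\<dagger> J = - J M\<close> on \<open>su(1,1)\<close>, differentiating the form of \<open>B\<close> along \<open>X' = M X\<close> gives
  the form of \<open>[B, M]\<close>. The pair on the right is the coordinate pair of the commutator of
  \<open>su11_elem b q\<close> and \<open>su11_elem a p\<close>: the multiple \<open>u B\<close> drops out.\<close>

lemma hform_derivative:
  "2 * hform b q X (su11_elem (a + u *\<^sub>R b) (p + u * q) ** X)
     = hform (\<i> * (q * a - p * b)) (Im (b * cnj a)) X X"
  by (simp add: hform_def su11_elem_def matrix_matrix_mult_def sum_2 algebra_simps)

text \<open>The Hermitian matrix has the eigenvalues \<open>z \<plusminus> \<bar>c\<bar>\<close>.\<close>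

lemma hform_nonneg:
  assumes "cmod c \<le> z"
  shows "0 \<le> hform c z X X"
proof -
  define v w where "v = X$1$1" and "w = X$2$1"
  have "- Re (c * v * cnj w) \<le> cmod (c * v * cnj w)"
    using abs_Re_le_cmod[of "c * v * cnj w"] by linarith
  also have "\<dots> = cmod c * (cmod v * cmod w)" by (simp add: norm_mult)
  also have "\<dots> \<le> z * (cmod v * cmod w)" using assms by (intro mult_right_mono) auto
  finally have "- 2 * Re (c * v * cnj w) \<le> z * (2 * cmod v * cmod w)" by simp
  also have "\<dots> \<le> z * ((cmod v)\<^sup>2 + (cmod w)\<^sup>2)"
    using assms norm_ge_zero[of c] sum_squares_bound[of "cmod v" "cmod w"]
    by (intro mult_left_mono) linarith+
  also have "\<dots> = hform c z X X - 2 * Re (c * v * cnj w)"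
    unfolding cmod_power2 by (simp add: hform_def v_def w_def power2_eq_square algebra_simps)
  finally show ?thesis by simp
qed

lemma hform_scale: "hform (of_real e * c) (e * z) X Y = e * hform c z X Y"
  by (simp add: hform_def algebra_simps)

lemma hform_one: "hform c z (mat 1) (mat 1) = z"
  by (simp add: hform_def mat_def)

section \<open>The causal commutator and the unreachable points\<close>

lemma nonneg_quadratic_discriminant:
  fixes \<alpha> \<beta> \<gamma> :: real
  assumes "\<And>u. 0 \<le> \<alpha> + 2 * \<beta> * u + \<gamma> * u\<^sup>2"
  shows "0 \<le> \<gamma>" and "\<beta>\<^sup>2 \<le> \<alpha> * \<gamma>"
proof -
  have \<alpha>: "0 \<le> \<alpha>" using assms[of 0] by simp
  show \<gamma>: "0 \<le> \<gamma>"
  proof (rule ccontr)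
    assume neg: "\<not> 0 \<le> \<gamma>"
    \<comment> \<open>adding the values at \<open>u\<close> and \<open>- u\<close> removes the linear term\<close>
    define u where "u = sqrt ((\<alpha> + 1) / - \<gamma>)"
    have "u\<^sup>2 = (\<alpha> + 1) / - \<gamma>" 
      using divide_nonneg_pos[of "\<alpha> + 1" "- \<gamma>"] \<alpha> neg by (simp add: u_def)
    then have "\<gamma> * u\<^sup>2 = - \<alpha> - 1" using neg by (simp add: field_simps)
    with assms[of u] assms[of "- u"] show False by simp
  qed
  show "\<beta>\<^sup>2 \<le> \<alpha> * \<gamma>"
  proof (cases "\<gamma> = 0")
    case True
    have "\<beta> = 0"
    proof (rule ccontr)
      assume "\<beta> \<noteq> 0"
      with assms[of "- (\<alpha> + 1) / (2 * \<beta>)"] True show False by (simp add: field_simps)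
    qed
    with True show ?thesis by simp
  next
    case False
    with \<gamma> have pos: "0 < \<gamma>" by simp
    have "\<alpha> + 2 * \<beta> * (- \<beta> / \<gamma>) + \<gamma> * (- \<beta> / \<gamma>)\<^sup>2 = \<alpha> - \<beta>\<^sup>2 / \<gamma>"
      using pos by (simp add: field_simps power2_eq_square)
    with assms[of "- \<beta> / \<gamma>"] have "\<beta>\<^sup>2 / \<gamma> \<le> \<alpha>" by simp
    with pos show ?thesis by (simp add: field_simps)
  qed
qed

text \<open>The identity behind the second conclusion is Lagrange's identity for the Minkowski cross
  product: the norm of \<open>[B, A]\<close> is the Gram determinant of \<open>A\<close> and \<open>B\<close> with the opposite sign,
  and that determinant is nonnegative because the Minkowski form at \<open>A + u B\<close>, a quadratic
  polynomial in \<open>u\<close>, is never negative. The first conclusion concerns its leading coefficient.\<close>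

lemma commutator_causal:
  assumes "\<And>u. (p + u * q)\<^sup>2 \<le> (cmod (a + u *\<^sub>R b))\<^sup>2"
  shows "q\<^sup>2 \<le> (cmod b)\<^sup>2" "cmod (\<i> * (q * a - p * b)) \<le> \<bar>Im (b * cnj a)\<bar>"
proof -
  define \<alpha> \<beta> \<gamma>
    where "\<alpha> = (cmod a)\<^sup>2 - p\<^sup>2" and "\<beta> = Re (b * cnj a) - p * q" and "\<gamma> = (cmod b)\<^sup>2 - q\<^sup>2"
  note defs = \<alpha>_def \<beta>_def \<gamma>_def cmod_power2
  \<comment> \<open>the Minkowski form at \<open>A + u B\<close>\<close>
  have "0 \<le> \<alpha> + 2 * \<beta> * u + \<gamma> * u\<^sup>2" for u
    using assms[of u] unfolding defs by (simp add: power2_eq_square algebra_simps)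
  note disc = nonneg_quadratic_discriminant[OF this]
  from disc(1) show "q\<^sup>2 \<le> (cmod b)\<^sup>2" by (simp add: \<gamma>_def)
  have "(Im (b * cnj a))\<^sup>2 - (cmod (\<i> * (q * a - p * b)))\<^sup>2 = \<alpha> * \<gamma> - \<beta>\<^sup>2"
    unfolding defs by (simp add: power2_eq_square algebra_simps)
  with disc(2) show "cmod (\<i> * (q * a - p * b)) \<le> \<bar>Im (b * cnj a)\<bar>"
    using abs_le_square_iff[of "cmod (\<i> * (q * a - p * b))" "Im (b * cnj a)"] by simp
qed

lemma integrand_bounded:
  fixes A B :: "complex^2^2" and X :: "real \<Rightarrow> complex^2^2"
  assumes u: "locally_bounded_measurable u" and X: "continuous_on {0..} X" and "0 \<le> t"
  obtains L where "\<And>s. s \<in> {0..t} \<Longrightarrow> norm ((A + u s *\<^sub>R B) ** X s) \<le> L"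
proof -
  interpret bounded_bilinear "(**) :: complex^2^2 \<Rightarrow> complex^2^2 \<Rightarrow> complex^2^2"
    by (rule bounded_bilinear_matrix_mult)
  obtain K where K: "0 \<le> K"
    "\<And>(M :: complex^2^2) (N :: complex^2^2). norm (M ** N) \<le> norm M * norm N * K"
    using nonneg_bounded by auto
  obtain c where c: "\<And>s. s \<in> {0..t} \<Longrightarrow> \<bar>u s\<bar> \<le> c"
    using u \<open>0 \<le> t\<close> unfolding locally_bounded_measurable_def bounded_iff by force
  have "bounded (X ` {0..t})"
    by (intro compact_imp_bounded compact_continuous_image continuous_on_subset[OF X]) auto
  then obtain d where d: "\<And>s. s \<in> {0..t} \<Longrightarrow> norm (X s) \<le> d"
    unfolding bounded_iff by force
  have "norm ((A + u s *\<^sub>R B) ** X s) \<le> (norm A + c * norm B) * d * K" if s: "s \<in> {0..t}" for s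
  proof -
    have "norm (A + u s *\<^sub>R B) \<le> norm A + c * norm B"
      using norm_triangle_ineq[of A "u s *\<^sub>R B"] mult_right_mono[OF c[OF s], of "norm B"] by simp
    then have "norm (A + u s *\<^sub>R B) * norm (X s) * K \<le> (norm A + c * norm B) * d * K"
      using d[OF s] K(1) norm_ge_zero[of "A + u s *\<^sub>R B"] norm_ge_zero[of "X s"]
      by (intro mult_right_mono mult_mono) linarith+
    with K(2)[of "A + u s *\<^sub>R B" "X s"] show ?thesis by linarith
  qed
  then show thesis by (rule that)
qed

text \<open>The sign \<open>e\<close> selects the causal cone, future or past, that contains the commutator.\<close>

lemma solution_hform_mono:
  assumes u: "locally_bounded_measurable u"
    and X: "solution (su11_elem a p) (su11_elem b q) u X" and t: "0 \<le> t"
    and causal: "cmod (\<i> * (q * a - p * b)) \<le> e * Im (b * cnj a)" and e: "\<bar>e\<bar> = 1"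
  shows "e * q \<le> e * hform b q (X t) (X t)"
proof -
  let ?g = "\<lambda>s. (su11_elem a p + u s *\<^sub>R su11_elem b q) ** X s"
  let ?S = "hform (of_real e * b) (e * q)"
  have cont: "continuous_on {0..} X"
    and int: "\<And>s. 0 \<le> s \<Longrightarrow> set_integrable lebesgue {0..s} ?g"
    and eq: "\<And>s. 0 \<le> s \<Longrightarrow> X s = mat 1 + (LINT r:{0..s}|lebesgue. ?g r)"
    using X unfolding solution_def by blast+
  obtain L where L: "\<And>s. s \<in> {0..t} \<Longrightarrow> norm (?g s) \<le> L"
    using integrand_bounded[OF u cont t] by blast
  have "?S (mat 1) (mat 1) \<le> ?S (X t) (X t)"
  proof (rule quadratic_form_mono_along_integral_curve[OF bounded_bilinear_hform hform_sym t _ _ L])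
    show "?g integrable_on {0..t}"
      by (rule set_lebesgue_integral_eq_integral(1)[OF int[OF t]])
    fix s assume s: "s \<in> {0..t}"
    then have "0 \<le> s" by simp
    from eq[OF this] show "X s = mat 1 + integral {0..s} ?g"
      unfolding set_lebesgue_integral_eq_integral(2)[OF int[OF \<open>0 \<le> s\<close>]] .
    have "cmod (of_real e * (\<i> * (q * a - p * b))) \<le> e * Im (b * cnj a)"
      using causal e by (simp add: norm_mult)
    from hform_nonneg[OF this, of "X s"]
    have "0 \<le> e * (2 * hform b q (X s) (?g s))"
      unfolding hform_scale su11_elem_line hform_derivative .
    then show "0 \<le> ?S (X s) (?g s)" unfolding hform_scale by simp
  qed
  then show ?thesis unfolding hform_scale hform_one .
qed

text \<open>On a boost with entries \<open>a = cosh s\<close> and \<open>\<bar>b'\<bar> = sinh s\<close> the form takes the value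
  \<open>q cosh 2s + cmod b sinh 2s cos \<theta>\<close>, where the angle \<open>\<theta>\<close> is free. Choosing
  \<open>e cos \<theta> = - 1\<close> and using \<open>cosh 2s - 1 < sinh 2s\<close> and \<open>\<bar>q\<bar> \<le> cmod b\<close> brings \<open>e\<close> times this value
  below \<open>e q\<close>, the value at the identity. The boost with \<open>cosh s = 5/4\<close> and \<open>sinh s = 3/4\<close> has
  rational entries, up to the phase.\<close>

lemma exists_SU11_hform_less:
  assumes "b \<noteq> 0" and "q\<^sup>2 \<le> (cmod b)\<^sup>2" and e: "\<bar>e\<bar> = 1"
  shows "\<exists>M\<in>SU11. e * hform b q M M < e * q"
proof -
  define w where "w = - of_real e * cnj b / of_real (cmod b)"
  define M :: "complex^2^2" where
    "M = vector [vector [5/4, 3/4 * w], vector [cnj (3/4 * w), cnj (5/4)]]"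
  have w: "cmod w = 1" using assms by (simp add: w_def norm_mult norm_divide)
  have "M \<in> SU11"
    unfolding SU11_def M_def mem_Collect_eq
    by (intro exI[of _ "5/4"] exI[of _ "3/4 * w"] conjI)
      (simp_all only: refl, simp add: norm_mult norm_divide w power2_eq_square)
  moreover have "e * hform b q M M < e * q"
  proof -
    have "hform b q M M = q * (25/16 + 9/16 * (cmod w)\<^sup>2) + 15/8 * Re (b * w)"
      unfolding cmod_power2
      by (simp add: hform_def M_def power2_eq_square field_simps)
    also have "b * w = of_real (- e * cmod b)"
      using assms(1) complex_norm_square[of b]
      by (simp add: w_def field_simps power2_eq_square)
    also have "q * (25/16 + 9/16 * (cmod w)\<^sup>2) + 15/8 * Re (of_real (- e * cmod b))
        = 17/8 * q - 15/8 * (e * cmod b)"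
      by (simp add: w)
    finally have val: "hform b q M M = 17/8 * q - 15/8 * (e * cmod b)" .
    have "e * hform b q M M = 17/8 * (e * q) - 15/8 * (e * e * cmod b)"
      unfolding val by (simp add: algebra_simps)
    also have "e * e = 1" using e abs_mult_self_eq[of e] by simp
    finally have "e * hform b q M M = 17/8 * (e * q) - 15/8 * cmod b" by simp
    moreover have "e * q \<le> cmod b"
    proof -
      have "e * q \<le> \<bar>q\<bar>" using e abs_ge_self[of "e * q"] by (simp add: abs_mult)
      also have "\<dots> \<le> cmod b" using assms(2) abs_le_square_iff[of q "cmod b"] by simp
      finally show ?thesis .
    qed
    moreover have "0 < cmod b" using assms(1) by simp
    ultimately show ?thesis by linarith
  qed
  ultimately show ?thesis by blast
qed

theorem mainTheorem2:
  fixes A B :: "complex^2^2" and U :: "(real \<Rightarrow> real) set"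
  assumes "A \<in> su11" and "B \<in> su11"
    and "A \<noteq> B" and "independent {A, B}"
    and "\<And>u. u \<in> U \<Longrightarrow> locally_bounded_measurable u"
    and "\<Omega> A B = {}"
  shows "\<not> controllable A B U"
proof
  assume contr: "controllable A B U"
  obtain a p where A: "A = su11_elem a p" using su11_elemE[OF assms(1)] .
  obtain b q where B: "B = su11_elem b q" using su11_elemE[OF assms(2)] .
  have "(p + u * q)\<^sup>2 \<le> (cmod (a + u *\<^sub>R b))\<^sup>2" for u
  proof -
    have "\<not> complex_of_real ((cmod (a + u *\<^sub>R b))\<^sup>2 - (p + u * q)\<^sup>2) < 0"
      using assms(6) unfolding elliptic_controls_def dagger_line A B su11_elem_line
        pairing_su11_elem by blast
    then show ?thesis unfolding less_complex_def by simp
  qed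
  note causal = commutator_causal[OF this]
  define e :: real where "e = (if Im (b * cnj a) < 0 then - 1 else 1)"
  have e: "\<bar>e\<bar> = 1" "\<bar>Im (b * cnj a)\<bar> = e * Im (b * cnj a)" by (auto simp: e_def)
  have "b \<noteq> 0"
  proof
    assume "b = 0"
    with causal(1) have "B = 0" by (simp add: B su11_elem_def vec_eq_iff forall_2)
    with assms(4) show False by (metis dependent_zero insertI1 insertI2)
  qed
  from exists_SU11_hform_less[OF this causal(1) e(1)]
  obtain M where M: "M \<in> SU11" "e * hform b q M M < e * q" by blast
  from M(1) contr obtain t u X
    where "0 \<le> t" "u \<in> U" "solution A B u X" "X t = M"
    unfolding controllable_def reachable_set_def by blast
  with solution_hform_mono[OF assms(5) _ _ causal(2)[unfolded e(2)] e(1)]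
  have "e * q \<le> e * hform b q M M" unfolding A B by blast
  with M(2) show False by simp
qed

end
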